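(* Let $S$ be a finite totally ordered set, let $d\ge1$, let $P$ be a PCA dynamics on $S^{\mathbb{Z}^d}$ and let $N\geq 2$. There exists an increasing synchronous coupling of the $N$-tuple $(P,\dots,P)$ if and only if $P$ is attractive.
   Context: A PCA (probabilistic cellular automaton) dynamics on $S^{\mathbb{Z}^d}$ ($S$ finite, partially ordered by $\preceq$; total order in the claim) is a time-homogeneous discrete-time Markov chain on $S^{\mathbb{Z}^d}$ with transition kernel of product form $P(d\sigma\mid\eta)=\bigotimes_{k\in\mathbb{Z}^d}p_k(d\sigma_k\mid\eta)$, where $p_k(\cdot\mid\eta)$ is a probability measure on $S$; all PCA are assumed local: for every $k$ there is a finite $V_k\subset\mathbb{Z}^d$ such that $p_k(\cdot\mid\eta)$ depends on $\eta$ only through $(\eta_j)_{j\in V_k}$. Order: $\sigma\preceq\eta$ iff $\sigma_k\preceq\eta_k$ for all $k$. A real function $f$ on $S^{\mathbb{Z}^d}$ is increasing if $\sigma\preceq\eta\Rightarrow f(\sigma)\le f(\eta)$. Attractive: $P$ is attractive if for every increasing (bounded measurable) function $f$ on $S^{\mathbb{Z}^d}$, the function $P(f)(\eta)=\int f(\sigma)P(d\sigma\mid\eta)$ is increasing. Synchronous coupling of PCA dynamics $P^1,\dots,P^N$, $P^i=\bigotimes_kp^i_k$ (here all equal to $P$): a Markovian dynamics $Q$ on $(S^{\mathbb{Z}^d})^N$ which is itself a (local) PCA dynamics (with spin space $S^N$), $Q=\bigotimes_{k}q_k$, such that for all $k$, $i$, $s^i\in S$ and $\zeta^1,\dots,\zeta^N\in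 S^{\mathbb{Z}^d}$, $p^i_k(s^i\mid\zeta^i)=\sum_{s^j\in S,\,j\ne i}q_k\big((s^1,\dots,s^N)\mid(\zeta^1,\dots,\zeta^N)\big)$. Increasing synchronous coupling: a synchronous coupling $Q$ such that for all initial configurations $\sigma^1\preceq\cdots\preceq\sigma^N$ and all times $n\ge1$, $Q\big(\omega^1(n)\preceq\cdots\preceq\omega^N(n)\mid(\omega^1,\dots,\omega^N)(0)=(\sigma^1,\dots,\sigma^N)\big)=1$. *)

theory Defs
  imports "HOL-Probability.Probability"
begin

text \<open>
  The lattice \<open>\<int>\<^sup>d\<close> is \<^typ>\<open>int ^ 'd\<close> with \<open>d = CARD('d)\<close>, the finite spin set is a finite type.
\<close>

type_synonym ('d, 'a) config = "int ^ 'd \<Rightarrow> 'a"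

text \<open>
  A PCA is given by its single-site kernels: \<open>p k \<eta>\<close> is the law \<open>p\<^sub>k(\<cdot> | \<eta>)\<close> of the new spin at \<open>k\<close>.
\<close>

type_synonym ('d, 'a) pca_rule = "int ^ 'd \<Rightarrow> ('d, 'a) config \<Rightarrow> 'a pmf"

definition config_space :: "('d::finite, 'a::finite) config measure" where
  "config_space = PiM UNIV (\<lambda>_. count_space UNIV)"

definition pca :: "('d::finite, 'a::finite) pca_rule \<Rightarrow> bool" where
  "pca p \<longleftrightarrow>
     (\<forall>k. \<exists>V. finite V \<and> (\<forall>\<eta> \<eta>'. (\<forall>j\<in>V. \<eta> j = \<eta>' j) \<longrightarrow> p k \<eta> = p k \<eta>'))"

definition pca_kernel ::
    "('d::finite, 'a::finite) pca_rule \<Rightarrow> ('d, 'a) config \<Rightarrow> ('d, 'a) config measure" where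
  "pca_kernel p \<eta> = PiM UNIV (\<lambda>k. measure_pmf (p k \<eta>))"

text \<open>
  \<open>pca_law p n \<eta>\<close> is the law at time \<open>n\<close> of the Markov chain started from \<open>\<eta>\<close>.
\<close>

primrec pca_law ::
    "('d::finite, 'a::finite) pca_rule \<Rightarrow> nat \<Rightarrow> ('d, 'a) config \<Rightarrow> ('d, 'a) config measure" where
  "pca_law p 0 \<eta> = return config_space \<eta>"
| "pca_law p (Suc n) \<eta> = pca_law p n \<eta> \<bind> pca_kernel p"

text \<open>
  The order on configurations is the library's pointwise order on functions, so that increasing
  functions are those satisfying \<^const>\<open>mono\<close>.
\<close>

definition attractive ::
    "(('d::finite, 's::{finite,order}) config \<Rightarrow> ('d, 's) config measure) \<Rightarrow> bool" where
  "attractive P \<longleftrightarrow>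
     (\<forall>f :: ('d, 's) config \<Rightarrow> real.
        mono f \<and> bounded (range f) \<and> f \<in> borel_measurable config_space \<longrightarrow>
        mono (\<lambda>\<eta>. \<integral>\<sigma>. f \<sigma> \<partial>P \<eta>))"

text \<open>
  The index set \<open>{1, \<dots>, N}\<close> is a finite linearly ordered type \<open>'n\<close> with \<open>N = CARD('n)\<close>, and
  \<open>S\<^sup>N\<close> is \<^typ>\<open>'n \<Rightarrow> 's\<close>. The following identifies \<open>(S\<^bsup>\<int>^d\<^esup>)\<^sup>N\<close> with \<open>(S\<^sup>N)\<^bsup>\<int>^d\<^esup>\<close>.
\<close>

definition joint :: "('n \<Rightarrow> ('d, 's) config) \<Rightarrow> ('d, 'n \<Rightarrow> 's) config" where
  "joint \<zeta> = (\<lambda>k i. \<zeta> i k)"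

definition component :: "('d, 'n \<Rightarrow> 's) config \<Rightarrow> 'n \<Rightarrow> ('d, 's) config" where
  "component \<omega> i = (\<lambda>k. \<omega> k i)"

definition synchronous_coupling ::
    "('n::finite \<Rightarrow> ('d::finite, 's::finite) pca_rule) \<Rightarrow> ('d, 'n \<Rightarrow> 's) pca_rule \<Rightarrow> bool" where
  "synchronous_coupling p q \<longleftrightarrow> pca q \<and>
     (\<forall>k i s \<zeta>. pmf (p i k (\<zeta> i)) s = (\<Sum>t | t i = s. pmf (q k (joint \<zeta>)) t))"

text \<open>
  For a family \<open>\<sigma>\<close> of configurations, \<^prop>\<open>mono \<sigma>\<close> says \<open>\<sigma>\<^sup>1 \<preceq> \<dots> \<preceq> \<sigma>\<^sup>N\<close>.
\<close>

definition increasing_synchronous_coupling ::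
    "('n::{finite,linorder} \<Rightarrow> ('d::finite, 's::{finite,order}) pca_rule) \<Rightarrow>
     ('d, 'n \<Rightarrow> 's) pca_rule \<Rightarrow> bool" where
  "increasing_synchronous_coupling p q \<longleftrightarrow> synchronous_coupling p q \<and>
     (\<forall>\<sigma>. mono \<sigma> \<longrightarrow>
        (\<forall>n\<ge>1. measure (pca_law q n (joint \<sigma>)) {\<omega>. mono (component \<omega>)} = 1))"

end

theory Submission
  imports Defs
begin

text \<open>
  If an increasing coupling exists, run it from an ordered family whose first member is \<open>\<sigma>\<close> and whose
  other members are \<open>\<eta>\<close>: after one step the marginals are ordered almost surely, so integrals of
  increasing functions are ordered. Conversely, attractiveness tested on the functions
  \<open>\<sigma> \<mapsto> 1(\<sigma>\<^sub>k > s)\<close> says that \<open>p\<^sub>k(\<cdot> | \<eta>)\<close> is stochastically increasing in \<open>\<eta>\<close>. As \<open>S\<close> is totally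
  ordered, at each site all \<open>N\<close> spins can be sampled by inverting their distribution functions at
  one common uniform variable, which preserves the order.
\<close>

section \<open>Quantile coupling on a finite linear order\<close>

text \<open>On a finite linear order the distribution function determines the law: the mass at
  \<open>s\<close> is the jump there, and \<open>{..<s}\<close> is either empty or
  \<open>{..r}\<close> with \<open>r\<close> the predecessor of \<open>s\<close>.\<close>

lemma pmf_eqI_atMost:
  fixes M N :: "'s::{finite,linorder} pmf"
  assumes "\<And>s. measure_pmf.prob M {..s} = measure_pmf.prob N {..s}"
  shows "M = N"
proof (rule pmf_eqI)
  fix s
  have eq: "measure_pmf.prob M {..<s} = measure_pmf.prob N {..<s}"
  proof (cases "{..<s} = {}")
    case False
    define r where "r = Max {..<s}"
    have "r < s" using Max_in[OF finite False] unfolding r_def by blast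
    moreover have "x \<le> r" if "x < s" for x
      unfolding r_def using that by (intro Max_ge) auto
    ultimately have "{..<s} = {..r}" by (auto intro: le_less_trans)
    then show ?thesis by (simp only: assms)
  qed (simp only: measure_empty)
  have diff: "pmf L s = measure_pmf.prob L {..s} - measure_pmf.prob L {..<s}" for L :: "'s pmf"
  proof -
    have "measure_pmf.prob L ({..s} - {..<s}) = measure_pmf.prob L {..s} - measure_pmf.prob L {..<s}"
      by (rule measure_pmf.finite_measure_Diff) auto
    moreover have "{..s} - {..<s} = {s}" by auto
    ultimately show ?thesis by (simp only: measure_pmf_single)
  qed
  show "pmf M s = pmf N s" unfolding diff eq assms ..
qed

text \<open>This is the generalized inverse of the distribution function of \<open>m\<close>. For
  \<open>u > 1\<close> the set is empty and \<open>Min\<close> has no specified value; the uniform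
  variable almost surely avoids such \<open>u\<close>.\<close>

definition quantile :: "'s::{finite,linorder} pmf \<Rightarrow> real \<Rightarrow> 's" where
  "quantile m u = Min {s. u \<le> measure_pmf.prob m {..s}}"

text \<open>The set under \<open>Min\<close> is upward closed, and for \<open>u \<le> 1\<close> it
  contains the greatest spin, so its minimum lies below \<open>s\<close> exactly when
  \<open>s\<close> belongs to it.\<close>

lemma quantile_le_iff:
  assumes "u \<le> 1"
  shows "quantile m u \<le> s \<longleftrightarrow> u \<le> measure_pmf.prob m {..s}"
proof -
  have "(UNIV :: 'a set) \<subseteq> {..Max UNIV}"
    unfolding subset_iff atMost_iff by (intro allI impI Max_ge[OF finite])
  then have "measure_pmf.prob m UNIV \<le> measure_pmf.prob m {..Max UNIV}"
    by (rule measure_pmf.finite_measure_mono) simp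
  with assms have "u \<le> measure_pmf.prob m {..Max UNIV}"
    unfolding measure_pmf_UNIV by (rule order_trans)
  then have ne: "{s. u \<le> measure_pmf.prob m {..s}} \<noteq> {}" by blast
  have up: "u \<le> measure_pmf.prob m {..s}" if "u \<le> measure_pmf.prob m {..r}" "r \<le> s" for r
    using that(1)
  proof (rule order_trans)
    show "measure_pmf.prob m {..r} \<le> measure_pmf.prob m {..s}"
      using that(2) by (intro measure_pmf.finite_measure_mono) auto
  qed
  have "quantile m u \<le> s \<longleftrightarrow> (\<exists>r\<in>{s. u \<le> measure_pmf.prob m {..s}}. r \<le> s)"
    unfolding quantile_def by (rule Min_le_iff[OF finite ne])
  then show ?thesis using up by blast
qed

text \<open>The quantile factors through the map sending \<open>u\<close> to the set under
  \<open>Min\<close>. That map has finitely many values, and each of its fibres is cut out by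
  finitely many threshold conditions on \<open>u\<close>. This covers every real \<open>u\<close>,
  also where \<open>Min\<close> is unspecified.\<close>

lemma measurable_quantile [measurable]:
  "quantile (m :: 's::{finite,linorder} pmf) \<in> borel \<rightarrow>\<^sub>M count_space UNIV"
proof -
  have "(\<lambda>u. {s. u \<le> measure_pmf.prob m {..s}}) -` {A} \<inter> space borel \<in> sets borel" for A
  proof -
    have "(\<lambda>u. {s. u \<le> measure_pmf.prob m {..s}}) -` {A} \<inter> space borel =
      {u \<in> space borel. \<forall>s\<in>UNIV. s \<in> A \<longleftrightarrow> u \<le> measure_pmf.prob m {..s}}"
      unfolding vimage_def set_eq_iff by blast
    also have "\<dots> \<in> sets borel" by measurable
    finally show ?thesis .
  qed
  then have "(\<lambda>u. {s. u \<le> measure_pmf.prob m {..s}}) \<in> borel \<rightarrow>\<^sub>M count_space UNIV"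
    by (subst measurable_count_space_eq2[OF finite]) blast
  then show ?thesis
    unfolding quantile_def by (rule measurable_compose) simp
qed

text \<open>A single uniform variable \<open>u\<close> drives all coordinates; this shared
  randomness is what makes the coupling monotone.\<close>

definition quantile_measure :: "('n::finite \<Rightarrow> 's::{finite,linorder} pmf) \<Rightarrow> ('n \<Rightarrow> 's) measure" where
  "quantile_measure m =
     distr (uniform_measure lborel {0..1}) (count_space UNIV) (\<lambda>u i. quantile (m i) u)"

definition quantile_coupling :: "('n::finite \<Rightarrow> 's::{finite,linorder} pmf) \<Rightarrow> ('n \<Rightarrow> 's) pmf" where
  "quantile_coupling m = Abs_pmf (quantile_measure m)"

lemma measurable_quantiles [measurable]:
  fixes m :: "'n::finite \<Rightarrow> 's::{finite,linorder} pmf"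
  shows "(\<lambda>u i. quantile (m i) u) \<in> borel \<rightarrow>\<^sub>M count_space UNIV"
proof -
  have "(\<lambda>u i. quantile (m i) u) -` {t} \<inter> space borel \<in> sets borel" for t
  proof -
    have "(\<lambda>u i. quantile (m i) u) -` {t} \<inter> space borel =
      {u \<in> space borel. \<forall>i\<in>UNIV. quantile (m i) u = t i}"
      unfolding vimage_def fun_eq_iff by blast
    also have "\<dots> \<in> sets borel" by measurable
    finally show ?thesis .
  qed
  then show ?thesis
    by (subst measurable_count_space_eq2[OF finite]) blast
qed

lemma measure_pmf_quantile_coupling: "measure_pmf (quantile_coupling m) = quantile_measure m"
proof -
  interpret U: prob_space "uniform_measure lborel {0..1::real}"
    by (rule prob_space_uniform_measure) auto
  have "prob_space (quantile_measure m)"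
    unfolding quantile_measure_def by (rule U.prob_space_distr) simp
  moreover have sets: "sets (quantile_measure m) = UNIV"
    by (simp add: quantile_measure_def)
  ultimately interpret Q: prob_space "quantile_measure m" by simp
  \<comment> \<open>The support condition for being a \<open>pmf\<close> holds because the whole
    type of tuples is finite, hence a countable set carrying the measure.\<close>
  have "AE x in quantile_measure m. measure (quantile_measure m) {x} \<noteq> 0"
    using Q.AE_support_countable[OF sets] by (metis AE_I2 UNIV_I countable_finite finite)
  then show ?thesis
    unfolding quantile_coupling_def
    using Q.prob_space_axioms sets by (intro Abs_pmf_inverse) auto
qed

text \<open>Inverse transform sampling: within the unit interval, the \<open>u\<close> whose
  quantile is at most \<open>s\<close> form the interval from 0 to the distribution function at
  \<open>s\<close>, whose length is that value.\<close>

lemma map_quantile_coupling: "map_pmf (\<lambda>t. t i) (quantile_coupling m) = m i"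
proof (rule pmf_eqI_atMost)
  fix s
  let ?F = "measure_pmf.prob (m i) {..s}"
  let ?U = "uniform_measure lborel {0..1::real}"
  have eq: "{0..1} \<inter> {u. quantile (m i) u \<le> s} = {0..?F}"
    using quantile_le_iff[of _ "m i" s] order_trans[OF _ measure_pmf.prob_le_1[of "m i" "{..s}"]]
    by auto
  have "measure_pmf.prob (map_pmf (\<lambda>t. t i) (quantile_coupling m)) {..s} =
    measure (quantile_measure m) {t. t i \<le> s}"
    by (simp add: vimage_def measure_pmf_quantile_coupling)
  also have "\<dots> = measure ?U {u. quantile (m i) u \<le> s}"
    unfolding quantile_measure_def by (subst measure_distr) (auto simp: vimage_def)
  also have "\<dots> = measure lborel ({0..1} \<inter> {u. quantile (m i) u \<le> s}) / measure lborel {0..1::real}"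
    by (rule measure_uniform_measure) (auto, measurable)
  also have "\<dots> = ?F" unfolding eq by simp
  finally show "measure_pmf.prob (map_pmf (\<lambda>t. t i) (quantile_coupling m)) {..s} = ?F" .
qed

text \<open>Larger indices have smaller distribution functions, so any spin reaching level
  \<open>u\<close> under \<open>m j\<close> also reaches it under \<open>m i\<close>. Hence the
  quantiles are ordered for every \<open>u \<le> 1\<close>, not merely on average.\<close>

lemma AE_mono_quantile_coupling:
  fixes m :: "'n::{finite,linorder} \<Rightarrow> 's::{finite,linorder} pmf"
  assumes "\<And>i j s. i \<le> j \<Longrightarrow> measure_pmf.prob (m j) {..s} \<le> measure_pmf.prob (m i) {..s}"
  shows "AE t in quantile_coupling m. mono t"
proof -
  have "mono (\<lambda>i. quantile (m i) u)" if "u \<le> 1" for u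
  proof (rule monoI)
    fix i j :: 'n assume "i \<le> j"
    have "u \<le> measure_pmf.prob (m j) {..quantile (m j) u}"
      using quantile_le_iff[OF that] by blast
    also have "\<dots> \<le> measure_pmf.prob (m i) {..quantile (m j) u}"
      using assms \<open>i \<le> j\<close> .
    finally show "quantile (m i) u \<le> quantile (m j) u"
      using quantile_le_iff[OF that] by blast
  qed
  then have "AE u in uniform_measure lborel {0..1}. mono (\<lambda>i. quantile (m i) u)"
    by (intro AE_uniform_measureI) auto
  then show ?thesis
    unfolding measure_pmf_quantile_coupling quantile_measure_def
    by (subst AE_distr_iff) auto
qed

section \<open>Kernels of probabilistic cellular automata\<close>

lemma sets_pca_kernel [simp, measurable_cong]: "sets (pca_kernel p \<eta>) = sets config_space"
  unfolding pca_kernel_def config_space_def by (rule sets_PiM_cong) auto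

lemma space_config_space [simp]: "space config_space = UNIV"
  by (simp add: config_space_def space_PiM)

lemma space_pca_kernel [simp]: "space (pca_kernel p \<eta>) = UNIV"
  by (simp add: pca_kernel_def space_PiM)

lemma prob_space_pca_kernel: "prob_space (pca_kernel p \<eta>)"
  unfolding pca_kernel_def by (intro prob_space_PiM prob_space_measure_pmf)

lemma measurable_config_component [measurable]:
  "(\<lambda>\<omega>. \<omega> k) \<in> config_space \<rightarrow>\<^sub>M count_space UNIV"
  unfolding config_space_def by measurable

lemma measurable_config_map:
  "(\<lambda>\<omega> k. g (\<omega> k)) \<in> config_space \<rightarrow>\<^sub>M config_space"
proof (subst (2) config_space_def, rule measurable_PiM_single')
  show "(\<lambda>\<omega>. g (\<omega> k)) \<in> config_space \<rightarrow>\<^sub>M count_space UNIV" for k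
    by (rule measurable_compose[OF measurable_config_component]) simp
qed simp

text \<open>Only finitely many patterns on \<open>V\<close> exist, so every preimage is a finite
  union of cylinders. The target is arbitrary with all subsets measurable, which allows application
  to the \<open>pmf\<close>-valued map \<open>p j\<close>.\<close>

lemma measurable_local:
  fixes F :: "('d::finite, 'a::finite) config \<Rightarrow> 'b"
  assumes "finite V" and loc: "\<And>\<eta> \<eta>'. (\<forall>j\<in>V. \<eta> j = \<eta>' j) \<Longrightarrow> F \<eta> = F \<eta>'"
  shows "F \<in> config_space \<rightarrow>\<^sub>M count_space UNIV"
proof (rule measurableI)
  fix A :: "'b set"
  let ?G = "{g \<in> PiE V (\<lambda>_. UNIV). F g \<in> A}"
  have "finite ?G" using \<open>finite V\<close> by (simp add: finite_PiE)
  have *: "F -` A \<inter> space config_space = (\<Union>g\<in>?G. {\<eta> \<in> space config_space. \<forall>j\<in>V. \<eta> j = g j})"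
  proof (intro set_eqI iffI)
    fix \<eta> assume "\<eta> \<in> F -` A \<inter> space config_space"
    \<comment> \<open>The restriction, \<open>undefined\<close> outside \<open>V\<close>, is the
      chosen representative of the pattern of the configuration on \<open>V\<close>.\<close>
    then have "F (restrict \<eta> V) \<in> A" using loc[of \<eta> "restrict \<eta> V"] by simp
    then show "\<eta> \<in> (\<Union>g\<in>?G. {\<eta> \<in> space config_space. \<forall>j\<in>V. \<eta> j = g j})"
      by (intro UN_I[of "restrict \<eta> V"]) auto
  next
    fix \<eta> assume "\<eta> \<in> (\<Union>g\<in>?G. {\<eta> \<in> space config_space. \<forall>j\<in>V. \<eta> j = g j})"
    then obtain g where "F g \<in> A" and eq: "\<forall>j\<in>V. \<eta> j = g j" by blast
    then show "\<eta> \<in> F -` A \<inter> space config_space" using loc[OF eq] by simp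
  qed
  have "(\<Union>g\<in>?G. {\<eta> \<in> space config_space. \<forall>j\<in>V. \<eta> j = g j}) \<in> sets config_space"
  proof (rule sets.finite_UN[OF \<open>finite ?G\<close>])
    fix g
    show "{\<eta> \<in> space config_space. \<forall>j\<in>V. \<eta> j = g j} \<in> sets config_space"
      using \<open>finite V\<close> by measurable
  qed
  then show "F -` A \<inter> space config_space \<in> sets config_space" unfolding * .
qed simp

text \<open>It suffices to test cylinders, which form an intersection-stable generator. The mass of
  a cylinder is a finite product of single-site probabilities, each measurable by locality.\<close>

lemma measurable_pca_kernel:
  fixes p :: "('d::finite, 'a::finite) pca_rule"
  assumes "pca p"
  shows "pca_kernel p \<in> config_space \<rightarrow>\<^sub>M prob_algebra config_space"
proof (rule measurable_prob_algebra_generated)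
  show "sets (config_space :: ('d, 'a) config measure) =
      sigma_sets (PiE UNIV (\<lambda>_. space (count_space UNIV))) (prod_algebra UNIV (\<lambda>_. count_space UNIV))"
    unfolding config_space_def by (rule sets_PiM)
  show "Int_stable (prod_algebra (UNIV :: (int^'d) set) (\<lambda>_. count_space (UNIV :: 'a set)))"
    by (rule Int_stable_prod_algebra)
  show "prod_algebra (UNIV :: (int^'d) set) (\<lambda>_. count_space (UNIV :: 'a set)) \<subseteq>
      Pow (PiE UNIV (\<lambda>_. space (count_space UNIV)))"
    by (rule prod_algebra_sets_into_space)
  fix A assume "A \<in> prod_algebra (UNIV :: (int^'d) set) (\<lambda>_. count_space (UNIV :: 'a set))"
  then obtain J E where A: "A = prod_emb UNIV (\<lambda>_. count_space UNIV) J (PiE J E)" and J: "finite J"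
    by (auto elim!: prod_algebraE)
  have "emeasure (pca_kernel p \<eta>) A = (\<Prod>j\<in>J. emeasure (p j \<eta>) (E j))" for \<eta>
  proof -
    have "A = prod_emb UNIV (\<lambda>k. measure_pmf (p k \<eta>)) J (PiE J E)"
      unfolding A by (simp add: prod_emb_def)
    then show ?thesis
      unfolding pca_kernel_def using J
      by (simp add: emeasure_PiM_emb prob_space_measure_pmf)
  qed
  moreover have "(\<lambda>\<eta>. emeasure (p j \<eta>) (E j)) \<in> borel_measurable config_space" for j
  proof -
    obtain V where V: "finite V" "\<forall>\<eta> \<eta>'. (\<forall>i\<in>V. \<eta> i = \<eta>' i) \<longrightarrow> p j \<eta> = p j \<eta>'"
      using assms unfolding pca_def by blast
    have "p j \<in> config_space \<rightarrow>\<^sub>M count_space UNIV"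
      by (rule measurable_local[OF V(1) V(2)[THEN spec, THEN spec, THEN mp]])
    then show ?thesis by (rule measurable_compose) simp
  qed
  ultimately show "(\<lambda>\<eta>. emeasure (pca_kernel p \<eta>) A) \<in> borel_measurable config_space"
    by simp
qed (simp_all add: prob_space_pca_kernel)

lemma pca_law_in_prob_algebra:
  assumes "pca p"
  shows "pca_law p n \<eta> \<in> space (prob_algebra config_space)"
proof (induction n)
  case 0
  show ?case by (simp add: space_prob_algebra prob_space_return)
next
  case (Suc n)
  then have "prob_space (pca_law p n \<eta> \<bind> pca_kernel p)"
    "sets (pca_law p n \<eta> \<bind> pca_kernel p) = sets config_space"
    using prob_space_bind' sets_bind' measurable_pca_kernel[OF assms] by blast+
  then show ?case by (simp add: space_prob_algebra)
qed

text \<open>Turns the coupling condition at time 1 into a statement about one application of the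
  kernel.\<close>

lemma pca_law_1:
  assumes "pca p"
  shows "pca_law p 1 \<eta> = pca_kernel p \<eta>"
  using bind_return[of "pca_kernel p" config_space config_space \<eta>]
    measurable_prob_algebraD[OF measurable_pca_kernel[OF assms]]
  by simp

text \<open>A sitewise map pulls cylinders back to cylinders, so both measures agree on all of them.
  With \<open>g\<close> the evaluation at an index \<open>i\<close>, this lifts the single-site
  marginal condition to whole configurations.\<close>

lemma distr_pca_kernel_map:
  fixes q :: "('d::finite, 'a::finite) pca_rule" and p :: "('d, 'b::finite) pca_rule"
  assumes "\<And>k. map_pmf g (q k \<xi>) = p k \<eta>"
  shows "distr (pca_kernel q \<xi>) config_space (\<lambda>\<omega> k. g (\<omega> k)) = pca_kernel p \<eta>"
proof -
  have meas: "(\<lambda>\<omega> k. g (\<omega> k)) \<in> pca_kernel q \<xi> \<rightarrow>\<^sub>M config_space"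
    using measurable_config_map[of g] by (simp cong: measurable_cong_sets)
  interpret prob_space "pca_kernel q \<xi>" by (rule prob_space_pca_kernel)
  interpret D: prob_space "distr (pca_kernel q \<xi>) config_space (\<lambda>\<omega> k. g (\<omega> k))"
    using meas by (rule prob_space_distr)
  show ?thesis
  proof (rule measure_eqI_PiM_infinite)
    show "sets (distr (pca_kernel q \<xi>) config_space (\<lambda>\<omega> k. g (\<omega> k))) =
        sets (PiM UNIV (\<lambda>k. measure_pmf (p k \<eta>)))"
      using sets_pca_kernel[of p \<eta>] by (simp add: pca_kernel_def)
    show "sets (pca_kernel p \<eta>) = sets (PiM UNIV (\<lambda>k. measure_pmf (p k \<eta>)))"
      by (simp add: pca_kernel_def)
    show "finite_measure (distr (pca_kernel q \<xi>) config_space (\<lambda>\<omega> k. g (\<omega> k)))"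
      by (rule D.finite_measure_axioms)
    fix A :: "int^'d \<Rightarrow> 'b set" and J :: "(int^'d) set"
    assume J: "finite J"
    let ?X = "prod_emb UNIV (\<lambda>k. measure_pmf (p k \<eta>)) J (PiE J A)"
    have X: "?X \<in> sets config_space"
      using sets_PiM_I[of J UNIV A "\<lambda>k. measure_pmf (p k \<eta>)"] J
      unfolding sets_pca_kernel[of p \<eta>, unfolded pca_kernel_def] by simp
    have "(\<lambda>\<omega> k. g (\<omega> k)) -` ?X = prod_emb UNIV (\<lambda>k. measure_pmf (q k \<xi>)) J (PiE J (\<lambda>k. g -` A k))"
      by (auto simp: prod_emb_def PiE_iff)
    then have "emeasure (distr (pca_kernel q \<xi>) config_space (\<lambda>\<omega> k. g (\<omega> k))) ?X =
      (\<Prod>k\<in>J. emeasure (q k \<xi>) (g -` A k))"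
      unfolding emeasure_distr[OF meas X] using J
      by (simp add: pca_kernel_def emeasure_PiM_emb prob_space_measure_pmf)
    also have "\<dots> = (\<Prod>k\<in>J. emeasure (p k \<eta>) (A k))"
      by (simp add: assms[symmetric])
    also have "\<dots> = emeasure (pca_kernel p \<eta>) ?X"
      using J by (simp add: pca_kernel_def emeasure_PiM_emb prob_space_measure_pmf)
    finally show "emeasure (distr (pca_kernel q \<xi>) config_space (\<lambda>\<omega> k. g (\<omega> k))) ?X =
      emeasure (pca_kernel p \<eta>) ?X" .
  qed
qed

section \<open>Synchronous couplings\<close>

text \<open>The sum over tuples with prescribed entry \<open>s\<close> at \<open>i\<close> is the
  mass at \<open>s\<close> of the image under evaluation at \<open>i\<close>, so the marginal
  condition is an equality of laws.\<close>

lemma synchronous_coupling_iff_map_pmf: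
  "synchronous_coupling p q \<longleftrightarrow>
     pca q \<and> (\<forall>k i \<zeta>. map_pmf (\<lambda>t. t i) (q k (joint \<zeta>)) = p i k (\<zeta> i))"
proof -
  have "(\<Sum>t | t i = s. pmf (q k (joint \<zeta>)) t) = pmf (map_pmf (\<lambda>t. t i) (q k (joint \<zeta>))) s"
    for i s k \<zeta>
    by (simp add: pmf_map vimage_def measure_measure_pmf_finite)
  then show ?thesis
    unfolding synchronous_coupling_def pmf_eq_iff by auto
qed

text \<open>Exchanging the quantifiers over indices and sites exhibits the ordering event as a
  countable intersection of single-site events. It is therefore measurable, and almost sure once it
  is so at each site.\<close>

lemma mono_component_iff: "mono (component \<omega>) \<longleftrightarrow> (\<forall>k. mono (\<omega> k))"
  unfolding mono_def component_def le_fun_def by auto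

lemma measurable_mono_component [measurable]:
  "Measurable.pred config_space
    (\<lambda>\<omega> :: ('d::finite, 'n::{finite,linorder} \<Rightarrow> 's::{finite,order}) config. mono (component \<omega>))"
  unfolding mono_component_iff by measurable

lemma AE_mono_pca_kernel:
  fixes q :: "('d::finite, 'n::{finite,linorder} \<Rightarrow> 's::{finite,order}) pca_rule"
  assumes "\<And>k. AE t in q k \<xi>. mono t"
  shows "AE \<omega> in pca_kernel q \<xi>. mono (component \<omega>)"
  unfolding mono_component_iff pca_kernel_def AE_all_countable
  using assms by (intro allI AE_PiM_component prob_space_measure_pmf) auto

text \<open>The set of ordered families is absorbing: one step from an ordered family almost surely
  stays ordered, and induction on time carries this through \<open>bind\<close>.\<close>

lemma AE_mono_pca_law:
  fixes q :: "('d::finite, 'n::{finite,linorder} \<Rightarrow> 's::{finite,order}) pca_rule"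
  assumes "pca q" and q: "\<And>k \<xi>. mono (component \<xi>) \<Longrightarrow> AE t in q k \<xi>. mono t"
    and "mono (component \<xi>)"
  shows "AE \<omega> in pca_law q n \<xi>. mono (component \<omega>)"
proof (induction n)
  case 0
  have "AE \<omega> in return config_space \<xi>. mono (component \<omega>)"
    using assms(3) by (subst AE_return) auto
  then show ?case unfolding pca_law.simps(1) .
next
  case (Suc n)
  have "sets (pca_law q n \<xi>) = sets config_space"
    using pca_law_in_prob_algebra[OF \<open>pca q\<close>] by (simp add: space_prob_algebra)
  then have K: "pca_kernel q \<in> pca_law q n \<xi> \<rightarrow>\<^sub>M subprob_algebra config_space"
    using measurable_prob_algebraD[OF measurable_pca_kernel[OF \<open>pca q\<close>]]
    using measurable_cong_sets[OF _ refl] by blast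
  have "AE \<omega> in pca_law q n \<xi>. AE \<omega>' in pca_kernel q \<omega>. mono (component \<omega>')"
    using Suc by eventually_elim (rule AE_mono_pca_kernel[OF q])
  then show ?case
    unfolding pca_law.simps by (subst AE_bind[OF K]) auto
qed

lemma attractive_if_coupling:
  fixes p :: "('d::finite, 's::{finite,order}) pca_rule"
    and q :: "('d, 'n::{finite,linorder} \<Rightarrow> 's) pca_rule"
  assumes "CARD('n) \<ge> 2" and coup: "increasing_synchronous_coupling (\<lambda>_. p) q"
  shows "attractive (pca_kernel p)"
  unfolding attractive_def
proof (intro allI impI monoI, elim conjE)
  fix f :: "('d, 's) config \<Rightarrow> real" and \<sigma> \<eta> :: "('d, 's) config"
  assume f: "mono f" "bounded (range f)" and [measurable]: "f \<in> borel_measurable config_space"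
    and "\<sigma> \<le> \<eta>"
  obtain B where B: "\<And>x. \<bar>f x\<bar> \<le> B" using f(2) by (auto simp: bounded_iff)
  have "pca q" and q: "\<And>k i \<zeta>. map_pmf (\<lambda>t. t i) (q k (joint \<zeta>)) = p k (\<zeta> i)"
    using coup unfolding increasing_synchronous_coupling_def synchronous_coupling_iff_map_pmf by auto
  \<comment> \<open>The extreme indices are comparable, and distinct since there are at least two
    indices. With \<open>a\<close> least, placing \<open>\<sigma>\<close> at \<open>a\<close> and
    \<open>\<eta>\<close> everywhere else gives an increasing family.\<close>
  define a b :: 'n where "a = Min UNIV" and "b = Max UNIV"
  have "a \<le> b" by (simp add: a_def b_def)
  moreover have "a \<noteq> b"
  proof
    assume "a = b"
    then have "x = a" for x :: 'n
      using Min_le[of UNIV x] Max_ge[of UNIV x] unfolding a_def b_def by (intro antisym) auto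
    then have "(UNIV :: 'n set) = {a}" by auto
    then have "CARD('n) = card {a}" by simp
    then show False using assms(1) by simp
  qed
  moreover define \<zeta> where "\<zeta> i = (if i = a then \<sigma> else \<eta>)" for i
  ultimately have \<zeta>: "\<zeta> a = \<sigma>" "\<zeta> b = \<eta>" by auto
  have "mono \<zeta>"
    using \<open>\<sigma> \<le> \<eta>\<close> by (auto simp: mono_def \<zeta>_def a_def Min_le antisym)
  let ?K = "pca_kernel q (joint \<zeta>)"
  interpret prob_space ?K by (rule prob_space_pca_kernel)
  have "measure ?K {\<omega>. mono (component \<omega>)} = 1"
    using coup \<open>mono \<zeta>\<close> pca_law_1[OF \<open>pca q\<close>]
    unfolding increasing_synchronous_coupling_def by (metis order_refl)
  moreover have ev: "{\<omega>. mono (component \<omega>)} \<in> sets ?K"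
    using measurable_mono_component[unfolded pred_def] by simp
  ultimately have AE: "AE \<omega> in ?K. mono (component \<omega>)"
    using prob_eq_1[OF ev] by simp
  have meas: "(\<lambda>\<omega>. component \<omega> i) \<in> ?K \<rightarrow>\<^sub>M config_space" for i
    using measurable_config_map[of "\<lambda>t. t i"] unfolding component_def
    by (simp cong: measurable_cong_sets)
  \<comment> \<open>Change of variables: component \<open>i\<close> of the coupled kernel has the
    law of one step of \<open>p\<close> from \<open>\<zeta> i\<close>.\<close>
  have marginal: "(\<integral>\<omega>. f (component \<omega> i) \<partial>?K) = (\<integral>x. f x \<partial>pca_kernel p (\<zeta> i))" for i
    using distr_pca_kernel_map[where g="\<lambda>t. t i" and q=q and \<xi>="joint \<zeta>" and p=p and \<eta>="\<zeta> i", OF q]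
      integral_distr[OF meas, of f i]
    by (simp add: component_def)
  have int: "integrable ?K (\<lambda>\<omega>. f (component \<omega> i))" for i
    using B meas[of i] by (intro integrable_const_bound[where B=B]) auto
  have "(\<integral>\<omega>. f (component \<omega> a) \<partial>?K) \<le> (\<integral>\<omega>. f (component \<omega> b) \<partial>?K)"
  proof (rule integral_mono_AE[OF int int])
    show "AE \<omega> in ?K. f (component \<omega> a) \<le> f (component \<omega> b)"
      using AE by eventually_elim (blast intro: monoD[OF f(1)] monoD[OF _ \<open>a \<le> b\<close>])
  qed
  then show "(\<integral>x. f x \<partial>pca_kernel p \<sigma>) \<le> (\<integral>x. f x \<partial>pca_kernel p \<eta>)"
    unfolding marginal \<zeta> .
qed

text \<open>The inequality is reversed because the increasing test function is the indicator of
  spins above \<open>s\<close> at site \<open>k\<close>, with integral one minus the distribution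
  function.\<close>

lemma attractive_imp_stochastically_increasing:
  fixes p :: "('d::finite, 's::{finite,linorder}) pca_rule"
  assumes "attractive (pca_kernel p)" and "\<sigma> \<le> \<eta>"
  shows "measure_pmf.prob (p k \<eta>) {..s} \<le> measure_pmf.prob (p k \<sigma>) {..s}"
proof -
  let ?f = "\<lambda>\<omega> :: ('d, 's) config. indicator {s<..} (\<omega> k) :: real"
  have "mono ?f"
    by (auto simp: mono_def le_fun_def split: split_indicator) (meson less_le_trans)
  moreover have "bounded (range ?f)"
    by (auto simp: bounded_iff intro!: exI[of _ 1] split: split_indicator)
  moreover have "?f \<in> borel_measurable config_space" by measurable
  ultimately have "mono (\<lambda>\<eta>. \<integral>\<omega>. ?f \<omega> \<partial>pca_kernel p \<eta>)"
    using assms(1) unfolding attractive_def by blast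
  moreover have "(\<integral>\<omega>. ?f \<omega> \<partial>pca_kernel p \<eta>) = 1 - measure_pmf.prob (p k \<eta>) {..s}" for \<eta>
  proof -
    \<comment> \<open>The test function sees only site \<open>k\<close>, and the projection of the
      product measure to \<open>k\<close> is the factor \<open>p k \<eta>\<close>.\<close>
    have "(\<integral>\<omega>. ?f \<omega> \<partial>pca_kernel p \<eta>) = (\<integral>x. indicator {s<..} x \<partial>p k \<eta>)"
      unfolding pca_kernel_def
      using distr_PiM_component[of UNIV "\<lambda>k. measure_pmf (p k \<eta>)" k]
        integral_distr[of "\<lambda>\<omega>. \<omega> k" "PiM UNIV (\<lambda>k. measure_pmf (p k \<eta>))" "measure_pmf (p k \<eta>)"
          "indicator {s<..} :: _ \<Rightarrow> real"]
        measurable_component_singleton[of k UNIV "\<lambda>k. measure_pmf (p k \<eta>)"]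
      by (simp add: prob_space_measure_pmf)
    also have "\<dots> = measure_pmf.prob (p k \<eta>) (UNIV - {..s})"
      by (simp add: Compl_eq_Diff_UNIV[symmetric])
    finally show ?thesis
      using measure_pmf.prob_compl[of "{..s}" "p k \<eta>"] by simp
  qed
  ultimately show ?thesis using assms(2) by (auto dest: monoD)
qed

lemma coupling_if_attractive:
  fixes p :: "('d::finite, 's::{finite,linorder}) pca_rule"
  assumes "pca p" and "attractive (pca_kernel p)"
  shows "\<exists>q :: ('d, 'n::{finite,linorder} \<Rightarrow> 's) pca_rule.
    increasing_synchronous_coupling (\<lambda>_. p) q"
proof -
  define q :: "('d, 'n \<Rightarrow> 's) pca_rule" where
    "q k \<xi> = quantile_coupling (\<lambda>i. p k (component \<xi> i))" for k \<xi>
  have "pca q"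
    unfolding pca_def
  proof
    fix k
    obtain V where V: "finite V" "\<And>\<eta> \<eta>'. (\<forall>j\<in>V. \<eta> j = \<eta>' j) \<Longrightarrow> p k \<eta> = p k \<eta>'"
      using assms(1) unfolding pca_def by blast
    \<comment> \<open>Joint configurations agreeing on \<open>V\<close> have all components agreeing
      on \<open>V\<close>, so the coupled rule inherits the neighbourhood of
      \<open>p\<close>.\<close>
    have "q k \<xi> = q k \<xi>'" if "\<forall>j\<in>V. \<xi> j = \<xi>' j" for \<xi> \<xi>'
      using V(2)[of "component \<xi> i" "component \<xi>' i" for i] that
      by (simp add: q_def component_def)
    then show "\<exists>V. finite V \<and> (\<forall>\<xi> \<xi>'. (\<forall>j\<in>V. \<xi> j = \<xi>' j) \<longrightarrow> q k \<xi> = q k \<xi>')"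
      using V(1) by blast
  qed
  have [simp]: "component (joint \<zeta>) = \<zeta>" for \<zeta> :: "'n \<Rightarrow> ('d, 's) config"
    unfolding component_def joint_def ..
  have sync: "synchronous_coupling (\<lambda>_. p) q"
    unfolding synchronous_coupling_iff_map_pmf
    using \<open>pca q\<close> by (auto simp: q_def map_quantile_coupling)
  \<comment> \<open>Ordered components have distribution functions at \<open>k\<close> that decrease
    in the index, as the quantile coupling requires.\<close>
  have "AE t in q k \<xi>. mono t" if "mono (component \<xi>)" for k \<xi>
    unfolding q_def using that
    by (intro AE_mono_quantile_coupling attractive_imp_stochastically_increasing[OF assms(2)])
      (rule monoD)
  note AE = AE_mono_pca_law[OF \<open>pca q\<close> this]
  have "measure (pca_law q n (joint \<sigma>)) {\<omega>. mono (component \<omega>)} = 1" if "mono \<sigma>" for \<sigma> n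
  proof -
    have P: "prob_space (pca_law q n (joint \<sigma>))"
      and sets: "sets (pca_law q n (joint \<sigma>)) = sets config_space"
      using pca_law_in_prob_algebra[OF \<open>pca q\<close>] by (auto simp: space_prob_algebra)
    have "{\<omega> \<in> space config_space. mono (component \<omega>)} \<in> sets (pca_law q n (joint \<sigma>))"
      unfolding sets by measurable
    then show ?thesis
      using prob_space.prob_eq_1[OF P] AE[of "joint \<sigma>" n] that by simp
  qed
  then show ?thesis
    using sync unfolding increasing_synchronous_coupling_def by blast
qed

theorem corollary2p5:
  fixes p :: "('d::finite, 's::{finite,linorder}) pca_rule"
  assumes "pca p" and "CARD('n::{finite,linorder}) \<ge> 2"
  shows "(\<exists>q :: ('d, 'n \<Rightarrow> 's) pca_rule. increasing_synchronous_coupling (\<lambda>_::'n. p) q)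
           \<longleftrightarrow> attractive (pca_kernel p)"
  using attractive_if_coupling[OF assms(2)] coupling_if_attractive[OF assms(1)] by blast

end
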